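(* Let $G$ be a finite group and let $n\in\pi_e(G)$ be such that $\Omega(n)$ is maximum among all elements of $\pi_e(G)$. Then $$gr(\mathcal{RP}^*(G))=\begin{cases}3,&\text{if }\Omega(n)\ge 3;\\ 4,&\text{if }\Omega(n)=2\text{ and }\pi_e(G)\nsubseteq\{1,4\}\cup\mathbb P;\\ \infty,&\text{otherwise.}\end{cases}$$
   Context: For a group $G$ with identity $e$, the reduced power graph $\mathcal{RP}(G)$ is the simple graph with vertex set $G$ in which $u,v$ are adjacent if and only if $\langle v\rangle\subset\langle u\rangle$ or $\langle u\rangle\subset\langle v\rangle$, where $\subset$ means proper inclusion. The proper reduced power graph $\mathcal{RP}^*(G)$ is the subgraph of $\mathcal{RP}(G)$ induced on $G\setminus\{e\}$. $\pi_e(G)$ denotes the set of orders of elements of $G$, $\mathbb P$ the set of all prime numbers, and $\Omega(n)$ the number of prime factors of $n$ counted with multiplicity. The girth $gr(\Gamma)$ is the length of a shortest cycle in $\Gamma$ if one exists, and $\infty$ otherwise. *)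

theory Defs
  imports
    "HOL-Algebra.Multiplicative_Group"
    "HOL-Computational_Algebra.Primes"
    "HOL-Library.Extended_Nat"
    "Graph_Theory.Graph_Theory"
begin

definition element_orders :: "('a, 'b) monoid_scheme \<Rightarrow> nat set" where
  "element_orders G = group.ord G ` carrier G"

definition big_omega :: "nat \<Rightarrow> nat" where
  "big_omega n = size (prime_factorization n)"

text \<open>
  A simple graph is represented as a symmetric loop-free digraph: every edge
  contributes an arc in each direction.
\<close>

definition reduced_power_graph :: "('a, 'b) monoid_scheme \<Rightarrow> 'a pair_pre_digraph" where
  "reduced_power_graph G =
    \<lparr> pverts = carrier G,
      parcs = {(u, v). u \<in> carrier G \<and> v \<in> carrier G \<and>
        (generate G {v} \<subset> generate G {u} \<or> generate G {u} \<subset> generate G {v})} \<rparr>"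

definition proper_reduced_power_graph ::
  "('a, 'b) monoid_scheme \<Rightarrow> ('a, 'a \<times> 'a) pre_digraph" where
  "proper_reduced_power_graph G =
    with_proj (reduced_power_graph G) \<restriction> (carrier G - {\<one>\<^bsub>G\<^esub>})"

text \<open>
  In a symmetric digraph the walk back and forth along one edge is a cycle of length 2
  in the sense of \<^const>\<open>pre_digraph.cycle\<close>; a cycle of a simple graph has length at
  least 3. The infimum of the empty set in \<^typ>\<open>enat\<close> is \<open>\<infinity>\<close>.
\<close>

definition girth :: "('a, 'b) pre_digraph \<Rightarrow> enat" where
  "girth H = (INF c \<in> {c. pre_digraph.cycle H c \<and> 3 \<le> length c}. enat (length c))"

lemma proper_reduced_power_graph_simple:
  assumes "finite (carrier G)"
  shows "graph (proper_reduced_power_graph G)"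
proof -
  have "pair_graph (reduced_power_graph G)"
    using assms
    by unfold_locales
      (auto simp: reduced_power_graph_def arcs_ends_def arc_to_ends_def symmetric_def
         with_proj_def intro!: symI intro: finite_subset[of _ "carrier G \<times> carrier G"])
  then interpret pair_graph "reduced_power_graph G" .
  have ind: "induced_subgraph (proper_reduced_power_graph G) (with_proj (reduced_power_graph G))"
    unfolding proper_reduced_power_graph_def
    by (rule induced_induce) (auto simp: reduced_power_graph_def)
  interpret H: digraph "proper_reduced_power_graph G"
    using ind by (rule digraphI_induced)
  interpret H: sym_digraph "proper_reduced_power_graph G"
    using ind by (rule induced_graph_imp_graph)
  show ?thesis
    by unfold_locales
qed

lemma girth_acyclic:
  "\<not> (\<exists>c. pre_digraph.cycle H c \<and> 3 \<le> length c) \<Longrightarrow> girth H = \<infinity>"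
  unfolding girth_def by (metis (no_types, lifting) Collect_empty_eq INF_empty top_enat_def)

lemma girth_attained:
  assumes "pre_digraph.cycle H c" "3 \<le> length c"
  shows "\<exists>c'. pre_digraph.cycle H c' \<and> 3 \<le> length c' \<and> girth H = enat (length c')"
proof -
  have "Inf ((\<lambda>c. enat (length c)) ` {c. pre_digraph.cycle H c \<and> 3 \<le> length c})
    \<in> (\<lambda>c. enat (length c)) ` {c. pre_digraph.cycle H c \<and> 3 \<le> length c}"
    using assms by (intro wellorder_InfI[of "enat (length c)"]) auto
  then show ?thesis
    by (auto simp: girth_def)
qed

end

theory Submission
  imports Defs
begin

text \<open>
  Let \<open>\<Omega>(u)\<close> abbreviate the value of \<open>\<Omega>\<close> at the order of \<open>u\<close>. If \<open>\<langle>u\<rangle>\<close> is properly contained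
  in \<open>\<langle>v\<rangle>\<close>, then the order of \<open>u\<close> is a proper divisor of the order of \<open>v\<close>, so
  \<open>\<Omega>(u) < \<Omega>(v)\<close>; thus \<open>\<Omega>\<close> is a proper colouring of the graph, and only the identity
  of \<open>G\<close> has colour \<open>0\<close>.

  If an element \<open>x\<close> has \<open>\<Omega>(x) \<ge> 3\<close>, split two primes \<open>p, q\<close> off its order: \<open>x\<close>, \<open>x\<^sup>p\<close> and
  \<open>x\<^sup>p\<^sup>q\<close> generate a strictly descending chain of nontrivial subgroups and form a triangle
  (\<open>girth_eq_3\<close>). If \<open>\<Omega> \<le> 2\<close> throughout, only the colours 1 and 2 remain, so there is no triangle
  (\<open>girth_ge_4\<close>). An order with \<open>\<Omega> \<le> 2\<close> outside \<open>{1, 4}\<close> that is not a prime has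
  an odd prime \<open>q\<close> as a proper divisor. If \<open>x\<close> has this order and \<open>a\<close> is a power of \<open>x\<close> of order \<open>q\<close>, neither
  is an involution, and \<open>a, x, a\<^sup>-\<^sup>1, x\<^sup>-\<^sup>1\<close> is a 4-cycle (\<open>girth_le_4\<close>).
  Finally, if all orders lie in \<open>{1, 4}\<close> or are prime, then every edge joins some \<open>x\<close> of order 4
  to its only neighbour \<open>x\<^sup>2\<close>; the components are stars and there is no cycle
  (\<open>girth_eq_infinity\<close>).
\<close>

section \<open>The number of prime factors\<close>

lemma big_omega_less:
  assumes "a dvd b" "a \<noteq> b" "b > 0"
  shows "big_omega a < big_omega b"
proof -
  have "a > 0" using assms by (auto intro: Nat.gr0I)
  then have "prime_factorization a \<subset># prime_factorization b"
    using assms prime_factorization_subset_iff_dvd[of a b] prime_factorization_unique[of a b]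
    by (auto simp: subset_mset_def)
  then show ?thesis unfolding big_omega_def by (rule mset_subset_size)
qed

lemma big_omega_1: "big_omega 1 = 0"
  by (simp add: big_omega_def)

lemma big_omega_prime: "prime p \<Longrightarrow> big_omega p = 1"
  by (simp add: big_omega_def prime_factorization_prime)

lemma big_omega_4: "big_omega 4 = 2"
proof -
  have "prime_factorization (2 * 2 :: nat) = {#2#} + {#2#}"
    by (subst prime_factorization_mult) (auto simp: prime_factorization_prime)
  then show ?thesis by (simp add: big_omega_def)
qed

lemma big_omega_split_prime:
  assumes "big_omega m > 0"
  obtains p k where "prime p" "m = p * k" "big_omega m = Suc (big_omega k)"
proof -
  have m: "m > 0" "m \<noteq> 1" using assms by (auto intro!: Nat.gr0I simp: big_omega_def)
  then obtain p where p: "prime p" "p dvd m" using prime_factor_nat by blast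
  then obtain k where k: "m = p * k" by blast
  have "big_omega m = Suc (big_omega k)"
    using m p k by (simp add: big_omega_def prime_factorization_mult prime_factorization_prime)
  then show ?thesis using that p k by blast
qed

lemma odd_prime_factor_if_big_omega_le_2:
  assumes "m > 0" "big_omega m \<le> 2" "m \<notin> {1, 4}" "\<not> prime m"
  obtains q where "prime q" "q > 2" "q dvd m" "q \<noteq> m"
proof -
  have "\<exists>q. prime q \<and> q > 2 \<and> q dvd m"
  proof (rule ccontr)
    assume no: "\<nexists>q. prime q \<and> q > 2 \<and> q dvd m"
    have two: "even d" if "d dvd m" "d \<noteq> 1" for d
    proof -
      obtain p where "prime p" "p dvd d" using prime_factor_nat \<open>d \<noteq> 1\<close> by blast
      moreover from this have "p = 2" using no that prime_ge_2_nat[of p]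
        by (metis dvd_trans le_neq_implies_less)
      ultimately show ?thesis by simp
    qed
    obtain k where k: "m = 2 * k" using two[of m] assms by auto
    have "k \<noteq> 1" using k assms by auto
    then obtain l where "k = 2 * l" using two[of k] k by auto
    then have "4 dvd m" using k by auto
    then have "big_omega 4 < big_omega m" using assms by (intro big_omega_less) auto
    then show False using assms by (simp add: big_omega_4)
  qed
  then show ?thesis using that assms by auto
qed

section \<open>Cyclic subgroups and adjacency\<close>

context group
begin

lemma generate_pow_subset:
  assumes "x \<in> carrier G"
  shows "generate G {x [^] (k::nat)} \<subseteq> generate G {x}"
proof (rule generate_subgroup_incl)
  show "subgroup (generate G {x}) G" using assms by (intro generate_is_subgroup) auto
  show "{x [^] k} \<subseteq> generate G {x}"
    using generate_pow[OF assms] int_pow_int[of G x k] by auto metis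
qed

lemma generate_inv:
  assumes "x \<in> carrier G"
  shows "generate G {inv x} = generate G {x}"
proof -
  have "generate G {inv y} \<subseteq> generate G {y}" if "y \<in> carrier G" for y
    using that by (intro generate_subgroup_incl generate_is_subgroup) (auto intro: generate.inv)
  from this[of x] this[of "inv x"] show ?thesis using assms by auto
qed

lemma inv_neq_self_if_ord_gt_2:
  assumes "x \<in> carrier G" "ord x > 2"
  shows "inv x \<noteq> x"
proof
  assume "inv x = x"
  then have "x [^] (2::nat) = \<one>"
    using assms r_inv[of x] by (simp add: numeral_2_eq_2)
  then have "ord x dvd 2" using assms pow_eq_id by blast
  then show False using assms by (auto dest: dvd_imp_le)
qed

lemma generate_psubset_iff_pow:
  assumes "finite (carrier G)" "x \<in> carrier G" "y \<in> carrier G"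
  shows "generate G {y} \<subset> generate G {x} \<longleftrightarrow> (\<exists>k::nat. y = x [^] k) \<and> ord y < ord x"
proof -
  have fin: "finite (generate G {x})"
    using assms generate_incl[of "{x}"] by (auto intro: finite_subset)
  have "y \<in> generate G {y}" by (auto intro: generate.incl)
  then have "generate G {y} \<subseteq> generate G {x} \<longleftrightarrow> (\<exists>k::nat. y = x [^] k)"
    using assms generate_pow_on_finite_carrier[of x] generate_pow_subset[of x] by blast
  then show ?thesis
    using assms fin by (auto simp: generate_pow_card dest: psubset_card_mono)
qed

lemma ord_properly_dvd_if_generate_psubset:
  assumes "finite (carrier G)" "x \<in> carrier G" "y \<in> carrier G"
    and "generate G {y} \<subset> generate G {x}"
  shows "ord y dvd ord x" "ord y \<noteq> ord x" "big_omega (ord y) < big_omega (ord x)"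
proof -
  obtain k :: nat where k: "y = x [^] k" "ord y < ord x"
    using assms generate_psubset_iff_pow by blast
  have "y [^] ord x = (x [^] ord x) [^] k"
    unfolding k(1) using assms(2) by (simp only: nat_pow_pow mult.commute)
  then have "y [^] ord x = \<one>" using assms(2) by simp
  then show "ord y dvd ord x" using assms pow_eq_id by blast
  moreover show "ord y \<noteq> ord x" using k by simp
  ultimately show "big_omega (ord y) < big_omega (ord x)"
    using k by (intro big_omega_less) auto
qed

lemma generate_pow_psubset_if_ord_eq:
  assumes "finite (carrier G)" "x \<in> carrier G" "ord x = d * k" "d > 1"
  shows "ord (x [^] d) = k" "generate G {x [^] d} \<subset> generate G {x}"
proof -
  have pos: "ord x > 0" using ord_ge_1[OF assms(1,2)] by simp
  show o: "ord (x [^] d) = k"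
    using assms pos by (subst ord_pow) auto
  have "k < d * k" using assms pos by auto
  then show "generate G {x [^] d} \<subset> generate G {x}"
    using assms o by (subst generate_psubset_iff_pow) auto
qed

end

lemma arc_proper_reduced_power_graph:
  "e \<in> arcs (proper_reduced_power_graph G) \<longleftrightarrow>
    fst e \<in> carrier G - {\<one>\<^bsub>G\<^esub>} \<and> snd e \<in> carrier G - {\<one>\<^bsub>G\<^esub>} \<and>
    (generate G {fst e} \<subset> generate G {snd e} \<or> generate G {snd e} \<subset> generate G {fst e})"
  by (cases e) (auto simp: proper_reduced_power_graph_def reduced_power_graph_def)

lemma proper_reduced_power_graph_simps:
  "verts (proper_reduced_power_graph G) = carrier G - {\<one>\<^bsub>G\<^esub>}"
  "tail (proper_reduced_power_graph G) = fst"
  "head (proper_reduced_power_graph G) = snd"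
  by (auto simp: proper_reduced_power_graph_def reduced_power_graph_def)

text \<open>
  Arcs are pairs of vertices, so a cycle is the list \<open>[(v\<^sub>1, v\<^sub>2), (v\<^sub>2, v\<^sub>3), \<dots>]\<close> of its arcs, and the
  equations below evaluate the cycle condition on any list of known shape.
\<close>

lemmas cycle_unfold = pre_digraph.cycle_def pre_digraph.awalk_def pre_digraph.cas.simps
  pre_digraph.awalk_verts.simps proper_reduced_power_graph_simps

section \<open>Cycles in the graph\<close>

lemma girth_leI:
  assumes "pre_digraph.cycle H c" "3 \<le> length c"
  shows "girth H \<le> enat (length c)"
  unfolding girth_def using assms by (intro INF_lower) auto

lemma girth_geI:
  assumes "\<And>c. pre_digraph.cycle H c \<Longrightarrow> 3 \<le> length c \<Longrightarrow> k \<le> length c"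
  shows "enat k \<le> girth H"
  unfolding girth_def using assms by (intro INF_greatest) auto

context group
begin

lemma big_omega_ord_pos:
  assumes "finite (carrier G)" "x \<in> carrier G - {\<one>}"
  shows "big_omega (ord x) > 0"
proof -
  have "ord x > 0" "ord x \<noteq> 1" using assms ord_ge_1[of x] ord_eq_1[of x] by auto
  then show ?thesis using big_omega_less[of 1 "ord x"] by (auto simp: big_omega_1)
qed

lemma girth_eq_3:
  assumes "finite (carrier G)" "x \<in> carrier G" "big_omega (ord x) \<ge> 3"
  shows "girth (proper_reduced_power_graph G) = 3"
proof -
  obtain p k where p: "prime p" "ord x = p * k" "big_omega (ord x) = Suc (big_omega k)"
    using big_omega_split_prime assms by (metis less_le_trans zero_less_numeral)
  obtain q l where q: "prime q" "k = q * l" "big_omega k = Suc (big_omega l)"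
    using big_omega_split_prime[of k] assms p by auto
  define y where "y = x [^] p"
  define z where "z = y [^] q"
  have y: "y \<in> carrier G" "ord y = k" "generate G {y} \<subset> generate G {x}"
    unfolding y_def using assms p prime_gt_1_nat generate_pow_psubset_if_ord_eq by auto
  have z: "z \<in> carrier G" "ord z = l" "generate G {z} \<subset> generate G {y}"
    unfolding z_def using assms y q prime_gt_1_nat generate_pow_psubset_if_ord_eq[of y q l] by auto
  have "w \<noteq> \<one>" if "big_omega (ord w) > 0" for w
    using that by (auto simp: big_omega_def)
  then have ne: "x \<noteq> \<one>" "y \<noteq> \<one>" "z \<noteq> \<one>" using assms y z p q by auto
  have xz: "generate G {z} \<subset> generate G {x}" using y z by blast
  have "x \<noteq> y" "y \<noteq> z" "x \<noteq> z" using y z xz by auto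
  then have "pre_digraph.cycle (proper_reduced_power_graph G) [(x, y), (y, z), (z, x)]"
    using assms y z ne xz by (auto simp: cycle_unfold arc_proper_reduced_power_graph)
  then have "girth (proper_reduced_power_graph G) \<le> enat 3"
    by (rule girth_leI[THEN order_trans]) auto
  moreover have "enat 3 \<le> girth (proper_reduced_power_graph G)" by (rule girth_geI)
  ultimately show ?thesis by (simp add: numeral_eq_enat)
qed

lemma girth_ge_4:
  assumes fin: "finite (carrier G)" and le: "\<And>x. x \<in> carrier G \<Longrightarrow> big_omega (ord x) \<le> 2"
  shows "girth (proper_reduced_power_graph G) \<ge> 4"
proof -
  have col: "big_omega (ord u) \<in> {1, 2} \<and> big_omega (ord v) \<in> {1, 2} \<and>
      big_omega (ord u) \<noteq> big_omega (ord v)"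
    if "(u, v) \<in> arcs (proper_reduced_power_graph G)" for u v
  proof -
    have uv: "u \<in> carrier G - {\<one>}" "v \<in> carrier G - {\<one>}"
      using that by (auto simp: arc_proper_reduced_power_graph)
    have "big_omega (ord u) \<noteq> big_omega (ord v)"
      using that uv ord_properly_dvd_if_generate_psubset(3)[OF fin, of u v]
        ord_properly_dvd_if_generate_psubset(3)[OF fin, of v u]
      unfolding arc_proper_reduced_power_graph fst_conv snd_conv
      by (metis DiffD1 less_irrefl)
    then show ?thesis
      using uv le[of u] le[of v] big_omega_ord_pos[OF fin, of u] big_omega_ord_pos[OF fin, of v]
      by auto
  qed
  have "4 \<le> length c"
    if cyc: "pre_digraph.cycle (proper_reduced_power_graph G) c" and len: "3 \<le> length c" for c
  proof (rule ccontr)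
    assume "\<not> 4 \<le> length c"
    with len have "length c = 3" by simp
    then obtain e f g where c: "c = [e, f, g]"
      by (auto simp: numeral_3_eq_3 length_Suc_conv)
    obtain u v w where "e = (u, v)" "f = (v, w)" "g = (w, u)"
      using cyc unfolding c by (cases e; cases f; cases g) (auto simp: cycle_unfold)
    then show False
      using cyc col[of u v] col[of v w] col[of w u] unfolding c by (auto simp: cycle_unfold)
  qed
  then have "enat 4 \<le> girth (proper_reduced_power_graph G)" by (rule girth_geI)
  then show ?thesis by (simp add: numeral_eq_enat)
qed

lemma girth_le_4:
  assumes fin: "finite (carrier G)" and x: "x \<in> carrier G"
    and q: "q > 2" "q dvd ord x" "q \<noteq> ord x"
  shows "girth (proper_reduced_power_graph G) \<le> 4"
proof -
  have pos: "ord x > 0" using ord_ge_1[OF fin x] by simp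
  obtain d where d: "ord x = d * q" using q by (auto simp: mult.commute)
  have d1: "d > 1" using d pos q by (cases d; cases "d - 1") auto
  have x2: "ord x > 2" using q pos by (auto dest: dvd_imp_le)
  define a where "a = x [^] d"
  have a: "a \<in> carrier G" "ord a = q" "generate G {a} \<subset> generate G {x}"
    unfolding a_def using fin x d d1 generate_pow_psubset_if_ord_eq by auto
  have inv: "inv a \<noteq> a" "inv x \<noteq> x"
    using a x x2 q by (auto dest: inv_neq_self_if_ord_gt_2)
  have gen: "generate G {inv a} = generate G {a}" "generate G {inv x} = generate G {x}"
    using a x by (simp_all add: generate_inv)
  have ne: "a \<noteq> \<one>" "x \<noteq> \<one>" "inv a \<noteq> \<one>" "inv x \<noteq> \<one>" using inv a x by auto
  have "distinct [a, x, inv a, inv x]" using inv a x gen by auto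
  then have "pre_digraph.cycle (proper_reduced_power_graph G)
      [(a, x), (x, inv a), (inv a, inv x), (inv x, a)]"
    using a x ne gen by (auto simp: cycle_unfold arc_proper_reduced_power_graph)
  then have "girth (proper_reduced_power_graph G) \<le> enat 4"
    by (rule girth_leI[THEN order_trans]) auto
  then show ?thesis by (simp add: numeral_eq_enat)
qed

lemma arc_joins_order_4_to_square:
  assumes fin: "finite (carrier G)" and ords: "element_orders G \<subseteq> {1, 4} \<union> {p. prime p}"
    and arc: "(u, v) \<in> arcs (proper_reduced_power_graph G)"
  shows "ord u = 4 \<and> v = u [^] (2::nat) \<or> ord v = 4 \<and> u = v [^] (2::nat)"
proof -
  have main: "ord y = 4 \<and> z = y [^] (2::nat)"
    if y: "y \<in> carrier G" and z: "z \<in> carrier G - {\<one>}"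
      and sub: "generate G {z} \<subset> generate G {y}" for y z
  proof -
    have dvd: "ord z dvd ord y" "ord z \<noteq> ord y" "ord z \<noteq> 1"
      using ord_properly_dvd_if_generate_psubset[OF fin y _ sub] z ord_eq_1[of z] by auto
    then have "\<not> prime (ord y)" "ord y \<noteq> 1" by (auto simp: prime_nat_iff)
    then have y4: "ord y = 4" using ords y by (auto simp: element_orders_def)
    obtain k :: nat where k: "z = y [^] k"
      using sub generate_psubset_iff_pow[OF fin y] z by blast
    have "ord z \<le> 4" using dvd y4 by (auto dest: dvd_imp_le)
    moreover have "ord z \<noteq> 3" using dvd(1) y4 by auto
    moreover have "ord z \<noteq> 0" using ord_ge_1[OF fin, of z] z by auto
    ultimately have "ord z = 2" using dvd y4 by linarith
    then have "z [^] (2::nat) = \<one>" using z by (metis DiffD1 pow_ord_eq_1)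
    then have "y [^] (k * 2) = \<one>" using y k by (simp add: nat_pow_pow)
    then have "4 dvd k * 2" using y y4 pow_eq_id by metis
    then obtain j where j: "k = 2 * j" by (auto elim!: dvdE)
    \<comment> \<open>Only the parity of \<open>j\<close> matters, and \<open>z \<noteq> \<one>\<close> excludes the even case.\<close>
    have "odd j"
    proof
      assume "even j"
      then have "4 dvd k" using j by auto
      then have "y [^] k = \<one>" using y y4 pow_eq_id by metis
      then show False using k z by auto
    qed
    then obtain i where "j = 2 * i + 1" by (auto elim: oddE)
    then have "z = (y [^] (4::nat)) [^] i \<otimes> y [^] (2::nat)"
      using y k j by (simp add: nat_pow_pow nat_pow_mult algebra_simps)
    moreover have "y [^] (4::nat) = \<one>" using y y4 by (metis pow_ord_eq_1)
    ultimately show ?thesis using y y4 by simp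
  qed
  show ?thesis
    using arc main[of u v] main[of v u] by (auto simp: arc_proper_reduced_power_graph)
qed

lemma girth_eq_infinity:
  assumes fin: "finite (carrier G)" and ords: "element_orders G \<subseteq> {1, 4} \<union> {p. prime p}"
  shows "girth (proper_reduced_power_graph G) = \<infinity>"
proof (rule girth_acyclic, rule notI)
  let ?H = "proper_reduced_power_graph G"
  assume "\<exists>c. pre_digraph.cycle ?H c \<and> 3 \<le> length c"
  then obtain c where cyc: "pre_digraph.cycle ?H c" and len: "3 \<le> length c" by blast
  then obtain e f g r where c: "c = e # f # g # r"
    by (auto simp: numeral_3_eq_3 Suc_le_length_iff)
  from cyc obtain a where a: "pre_digraph.awalk ?H a c a"
    "distinct (tl (pre_digraph.awalk_verts ?H a c))"
    by (auto simp: pre_digraph.cycle_def)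
  obtain b d h where efg: "e = (a, b)" "f = (b, d)" "g = (d, h)"
    using a unfolding c by (cases e; cases f; cases g) (auto simp: cycle_unfold)
  have arcs: "(a, b) \<in> arcs ?H" "(b, d) \<in> arcs ?H" "(d, h) \<in> arcs ?H"
    using a unfolding c efg by (auto simp: cycle_unfold)
  \<comment> \<open>The walk is closed, so the base point \<open>a\<close> reappears after \<open>d\<close> and is covered by distinctness.\<close>
  have "w \<in> set (pre_digraph.awalk_verts ?H k s)" if "pre_digraph.cas ?H k s w" for k s w
    using that by (induction s arbitrary: k) (auto simp: cycle_unfold)
  moreover have "pre_digraph.cas ?H h r a"
    using a unfolding c efg by (auto simp: cycle_unfold)
  ultimately have "a \<in> set (pre_digraph.awalk_verts ?H h r)" by blast
  then have ne: "a \<noteq> d"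
    using a unfolding c efg by (auto simp: cycle_unfold)
  have "h \<in> set (pre_digraph.awalk_verts ?H h r)"
    using a unfolding c efg by (cases r) (auto simp: cycle_unfold)
  then have ne': "b \<noteq> h"
    using a unfolding c efg by (auto simp: cycle_unfold)
  \<comment> \<open>Whichever of \<open>b\<close>, \<open>d\<close> has order 4 has two distinct neighbours, yet its square is the only one.\<close>
  have sq: "ord (y [^] (2::nat)) = 2" if "ord y = 4" "y \<in> carrier G" for y
    using that by (subst ord_pow) auto
  have car: "a \<in> carrier G" "b \<in> carrier G" "d \<in> carrier G" "h \<in> carrier G"
    using arcs by (auto simp: arc_proper_reduced_power_graph)
  show False
    using arc_joins_order_4_to_square[OF fin ords arcs(1)] arc_joins_order_4_to_square[OF fin ords arcs(2)]
      arc_joins_order_4_to_square[OF fin ords arcs(3)] ne ne' car sq by force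
qed

end

section \<open>The girth\<close>

theorem theorem2p6:
  fixes G :: "('a, 'b) monoid_scheme" and n :: nat
  assumes "group G"
    and "finite (carrier G)"
    and "n \<in> element_orders G"
    and "\<And>m. m \<in> element_orders G \<Longrightarrow> big_omega m \<le> big_omega n"
  shows "girth (proper_reduced_power_graph G) =
    (if big_omega n \<ge> 3 then 3
     else if big_omega n = 2 \<and> \<not> element_orders G \<subseteq> {1, 4} \<union> {p. prime p} then 4
     else \<infinity>)"
proof -
  interpret group G by fact
  note fin = \<open>finite (carrier G)\<close>
  obtain x where x: "x \<in> carrier G" "n = ord x"
    using assms(3) by (auto simp: element_orders_def)
  have le: "big_omega (ord y) \<le> big_omega n" if "y \<in> carrier G" for y
    using assms(4) that by (auto simp: element_orders_def)
  consider (three) "big_omega n \<ge> 3"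
    | (two) "big_omega n = 2" "\<not> element_orders G \<subseteq> {1, 4} \<union> {p. prime p}"
    | (star) "big_omega n = 2" "element_orders G \<subseteq> {1, 4} \<union> {p. prime p}"
    | (one) "big_omega n \<le> 1" by linarith
  then show ?thesis
  proof cases
    case three
    then show ?thesis using girth_eq_3[OF fin x(1)] x by simp
  next
    case two
    then obtain y where y: "y \<in> carrier G" "ord y \<notin> {1, 4}" "\<not> prime (ord y)"
      by (auto simp: element_orders_def)
    then obtain q where "q > 2" "q dvd ord y" "q \<noteq> ord y"
      using odd_prime_factor_if_big_omega_le_2[of "ord y"] le[OF y(1)] two(1) ord_ge_1[OF fin y(1)]
      by (metis gr0I not_one_le_zero)
    then have "girth (proper_reduced_power_graph G) = 4"
      using girth_le_4[OF fin y(1)] girth_ge_4[OF fin] le two by (metis order_antisym)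
    then show ?thesis using two by simp
  next
    case star
    then show ?thesis using girth_eq_infinity[OF fin] by simp
  next
    case one
    have "ord y = 1 \<or> prime (ord y)" if y: "y \<in> carrier G" for y
    proof (cases "big_omega (ord y) = 0")
      case True
      then show ?thesis using big_omega_ord_pos[OF fin, of y] y by (cases "y = \<one>\<^bsub>G\<^esub>") auto
    next
      case False
      then obtain p k where p: "prime p" "ord y = p * k" "big_omega (ord y) = Suc (big_omega k)"
        using big_omega_split_prime by blast
      have "k > 0" using p(2) ord_ge_1[OF fin y] by (auto intro: Nat.gr0I)
      moreover have "big_omega k = 0" using p le[OF y] one by simp
      ultimately have "k = 1" using big_omega_less[of 1 k] by auto
      then show ?thesis using p by simp
    qed
    then have "element_orders G \<subseteq> {1, 4} \<union> {p. prime p}" by (auto simp: element_orders_def)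
    then show ?thesis using girth_eq_infinity[OF fin] one by simp
  qed
qed

end
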